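(* Consider any recursive rational forecasting system $\varphi_r$ and any path $\omega\in\{0,1\}^{\mathbb{N}}$. If $\omega$ is Martin-Löf random for $\varphi_r$ and $(\varphi_r[\omega],\omega)$ is non-degenerate, then the prequential path $(\varphi_r[\omega],\omega)$ is game-random.
   Context: Let $\mathcal{X}=\{0,1\}$, $\mathbb{N}=\{1,2,\dots\}$ and $\mathbb{N}_0=\mathbb{N}\cup\{0\}$. An interval forecast is a non-empty closed interval $I\subseteq[0,1]$ (possibly a single point); $\mathcal{I}_r$ is the set of all interval forecasts with rational endpoints. For an interval forecast $I$ and $f\colon\mathcal{X}\to\mathbb{R}$, the upper expectation is $\overline{E}_I(f)=\max_{p\in I}[pf(1)+(1-p)f(0)]$. Situations are the elements $w$ of $\mathcal{X}^*=\bigcup_{k\in\mathbb{N}_0}\mathcal{X}^k$; $\square$ is the empty situation and $wx$ is the concatenation of $w$ with $x\in\mathcal{X}$. A path is an element $\omega=(\omega_1,\omega_2,\dots)\in\mathcal{X}^{\mathbb{N}}$, with prefixes $\omega_{1:n}$ of length $n$. Prequential situations are the elements $v=(I_1,x_1,\dots,I_n,x_n)$ of $(\mathcal{I}_r\times\mathcal{X})^*=\bigcup_{k\in\mathbb{N}_0}(\mathcal{I}_r\times\mathcal{X})^k$, with the empty one also denoted $\square$; $vI_rx$ is the concatenation of $v$ with $I_r\in\mathcal{I}_r$ and $x\in\mathcal{X}$. A prequential path is $\upsilon=(I_1,x_1,I_2,x_2,\dots)\in(\mathcal{I}_r\times\mathcal{X})^{\mathbb{N}}$, identified with the pair $(\iota,\omega)$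 where $\iota=(I_1,I_2,\dots)$ and $\omega=(x_1,x_2,\dots)$; $\upsilon_{1:n}=(I_1,x_1,\dots,I_n,x_n)$. It is non-degenerate if $\iota_n\neq\{1-\omega_n\}$ for all $n\in\mathbb{N}$. A rational forecasting system is a map $\varphi_r\colon\mathcal{X}^*\to\mathcal{I}_r$; it is recursive if $w\mapsto\min\varphi_r(w)$ and $w\mapsto\max\varphi_r(w)$ are recursive (Turing-computable, via encodings) rational maps. For a path $\omega$, $\varphi_r[\omega]=(\varphi_r(\omega_{1:0}),\varphi_r(\omega_{1:1}),\varphi_r(\omega_{1:2}),\dots)$. A map $r\colon\mathcal{D}\to\mathbb{R}$ on a countable encoded set $\mathcal{D}$ is lower semicomputable if there is a recursive map $q\colon\mathcal{D}\times\mathbb{N}_0\to\mathbb{Q}$ with $q(d,n)\leq q(d,n+1)$ and $\lim_{m\to\infty}q(d,m)=r(d)$ for all $d,n$. A test supermartingale for $\varphi_r$ is a map $T\colon\mathcal{X}^*\to\mathbb{R}$ with $T\geq0$, $T(\square)=1$ and $\overline{E}_{\varphi_r(w)}(T(w\,\cdot))\leq T(w)$ for all $w\in\mathcal{X}^*$, where $T(w\,\cdot)$ is the map $x\mapsto T(wx)$. A path $\omega$ is Martin-Löf random for $\varphi_r$ if $\limsup_{n\to\infty}T(\omega_{1:n})<\infty$ for all lower semicomputable test supermartingales $T$ for $\varphi_r$. A test superfarthingale is a map $F\colon(\mathcal{I}_r\times\mathcal{X})^*\to\mathbb{R}$ with $F\geq0$, $F(\square)=1$ and $\overline{E}_{I_r}(F(vI_r\,\cdot))\leq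 F(v)$ for all prequential situations $v$ and all $I_r\in\mathcal{I}_r$, where $F(vI_r\,\cdot)$ is the map $x\mapsto F(vI_rx)$. A prequential path $\upsilon$ is game-random if it is non-degenerate and all lower semicomputable test superfarthingales $F$ satisfy $\limsup_{n\to\infty}F(\upsilon_{1:n})<\infty$. *)

theory Defs
  imports Complex_Main "HOL-Library.Extended_Real" "HOL-Library.Nat_Bijection"
begin

section \<open>Recursive maps\<close>

text \<open>
  Kleene's partial recursive functions: programs together with their big-step semantics
  (\<open>rec_eval p xs y\<close>: program \<open>p\<close> halts on arguments \<open>xs\<close> with value \<open>y\<close>).
  A program diverges on \<open>xs\<close> when no such \<open>y\<close> exists.
\<close>

datatype recf =
    Zero
  | Succ
  | Proj nat
  | Comp recf "recf list"
  | PrimRec recf recf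
  | Mu recf

inductive rec_eval :: "recf \<Rightarrow> nat list \<Rightarrow> nat \<Rightarrow> bool" where
  zero: "rec_eval Zero xs 0"
| succ: "rec_eval Succ [x] (Suc x)"
| proj: "i < length xs \<Longrightarrow> rec_eval (Proj i) xs (xs ! i)"
| comp: "list_all2 (\<lambda>g y. rec_eval g xs y) gs ys \<Longrightarrow> rec_eval f ys z
           \<Longrightarrow> rec_eval (Comp f gs) xs z"
| prim_0: "rec_eval f xs y \<Longrightarrow> rec_eval (PrimRec f g) (0 # xs) y"
| prim_Suc: "rec_eval (PrimRec f g) (n # xs) r \<Longrightarrow> rec_eval g (n # r # xs) y
           \<Longrightarrow> rec_eval (PrimRec f g) (Suc n # xs) y"
| mu: "rec_eval f (n # xs) 0 \<Longrightarrow> (\<forall>m<n. \<exists>k. rec_eval f (m # xs) (Suc k))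
           \<Longrightarrow> rec_eval (Mu f) xs n"

inductive_cases rec_eval_elims:
  "rec_eval Zero xs z"
  "rec_eval Succ xs z"
  "rec_eval (Proj i) xs z"
  "rec_eval (Comp f gs) xs z"
  "rec_eval (PrimRec f g) (0 # xs) z"
  "rec_eval (PrimRec f g) (Suc n # xs) z"
  "rec_eval (Mu f) xs z"

lemma rec_eval_deterministic: "rec_eval p xs y \<Longrightarrow> rec_eval p xs z \<Longrightarrow> y = z"
proof (induction arbitrary: z rule: rec_eval.induct)
  case (zero xs)
  then show ?case by (rule rec_eval_elims(1)) simp
next
  case (succ x)
  then show ?case by (rule rec_eval_elims(2)) simp
next
  case (proj i xs)
  from proj(2) show ?case by (rule rec_eval_elims(3)) simp
next
  case (comp xs gs ys f z')
  from comp.prems obtain ys' where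
    ys': "list_all2 (\<lambda>g y. rec_eval g xs y) gs ys'" and z: "rec_eval f ys' z"
    by (rule rec_eval_elims(4))
  have "ys = ys'"
  proof (rule nth_equalityI)
    show "length ys = length ys'"
      using comp.IH(1) ys' by (simp add: list_all2_conv_all_nth)
    show "ys ! i = ys' ! i" if "i < length ys" for i
      using that comp.IH(1) ys' by (simp add: list_all2_conv_all_nth)
  qed
  with z comp.IH(2) show ?case by simp
next
  case (prim_0 f xs y g)
  from prim_0.prems have "rec_eval f xs z" by (rule rec_eval_elims(5))
  then show ?case by (rule prim_0.IH)
next
  case (prim_Suc f g n xs r y)
  from prim_Suc.prems obtain r' where
    "rec_eval (PrimRec f g) (n # xs) r'" and z: "rec_eval g (n # r' # xs) z"
    by (rule rec_eval_elims(6))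
  then have "r = r'" by (intro prim_Suc.IH(1))
  with z show ?case by (intro prim_Suc.IH(2)) simp
next
  case (mu f n xs)
  from mu.prems have z: "rec_eval f (z # xs) 0"
    by (rule rec_eval_elims(7))
  from mu.prems have below: "\<forall>m<z. \<exists>k. rec_eval f (m # xs) (Suc k)"
    by (rule rec_eval_elims(7))
  show ?case
  proof (rule linorder_cases[of n z])
    assume "n < z"
    with below obtain k where "rec_eval f (n # xs) (Suc k)" by blast
    from mu.IH(1)[OF this] show ?thesis by simp
  next
    assume "z < n"
    with mu.IH(2) obtain k where "\<forall>y. rec_eval f (z # xs) y \<longrightarrow> Suc k = y" by blast
    with z have "Suc k = 0" by blast
    then show ?thesis by simp
  qed
qed

text \<open>
  Recursiveness of a total map between two encoded sets. The encodings are explicit parameters: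
  \<^const>\<open>to_nat\<close> of class \<^class>\<open>countable\<close> is obtained by choice and need not be effective.
\<close>

definition recursive_map :: "('d \<Rightarrow> nat) \<Rightarrow> ('r \<Rightarrow> nat) \<Rightarrow> ('d \<Rightarrow> 'r) \<Rightarrow> bool" where
  "recursive_map enc_d enc_r f \<longleftrightarrow> (\<exists>p. \<forall>d. rec_eval p [enc_d d] (enc_r (f d)))"

definition rat_encode :: "rat \<Rightarrow> nat" where
  "rat_encode q = (case quotient_of q of (a, b) \<Rightarrow> prod_encode (int_encode a, int_encode b))"

lemma inj_rat_encode: "inj rat_encode"
  by (rule injI) (auto simp: rat_encode_def prod_encode_eq int_encode_eq
      split: prod.splits intro: quotient_of_inject)

definition lower_semicomputable :: "('d \<Rightarrow> nat) \<Rightarrow> ('d \<Rightarrow> real) \<Rightarrow> bool" where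
  "lower_semicomputable enc r \<longleftrightarrow>
     (\<exists>q :: 'd \<times> nat \<Rightarrow> rat.
        recursive_map (\<lambda>(d, n). prod_encode (enc d, n)) rat_encode q \<and>
        (\<forall>d n. q (d, n) \<le> q (d, Suc n)) \<and>
        (\<forall>d. (\<lambda>m. real_of_rat (q (d, m))) \<longlonglongrightarrow> r d))"


section \<open>Interval forecasts\<close>

definition interval_forecast :: "real set \<Rightarrow> bool" where
  "interval_forecast I \<longleftrightarrow> (\<exists>a b. 0 \<le> a \<and> a \<le> b \<and> b \<le> 1 \<and> I = {a..b})"

typedef rational_forecast =
  "{I. interval_forecast I \<and> Inf I \<in> \<rat> \<and> Sup I \<in> \<rat>}"
  morphisms forecast_set Abs_rational_forecast
proof -
  have "interval_forecast {0..1}"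
    unfolding interval_forecast_def by (intro exI[of _ 0] exI[of _ 1]) simp
  then show ?thesis by (intro exI[of _ "{0..1}"]) simp
qed

definition lower :: "rational_forecast \<Rightarrow> rat" where
  "lower I = (THE q. real_of_rat q = Inf (forecast_set I))"

definition upper :: "rational_forecast \<Rightarrow> rat" where
  "upper I = (THE q. real_of_rat q = Sup (forecast_set I))"

lemma of_rat_lower: "real_of_rat (lower I) = Inf (forecast_set I)"
proof -
  have "Inf (forecast_set I) \<in> \<rat>" using forecast_set[of I] by simp
  then obtain q where "Inf (forecast_set I) = real_of_rat q" by (rule Rats_cases)
  then show ?thesis by (simp add: lower_def)
qed

lemma of_rat_upper: "real_of_rat (upper I) = Sup (forecast_set I)"
proof -
  have "Sup (forecast_set I) \<in> \<rat>" using forecast_set[of I] by simp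
  then obtain q where "Sup (forecast_set I) = real_of_rat q" by (rule Rats_cases)
  then show ?thesis by (simp add: upper_def)
qed

lemma forecast_set_eq: "forecast_set I = {real_of_rat (lower I)..real_of_rat (upper I)}"
proof -
  obtain a b where "a \<le> b" "forecast_set I = {a..b}"
    using forecast_set[of I] by (auto simp: interval_forecast_def)
  then show ?thesis by (simp add: of_rat_lower of_rat_upper)
qed

definition forecast_encode :: "rational_forecast \<Rightarrow> nat" where
  "forecast_encode I = prod_encode (rat_encode (lower I), rat_encode (upper I))"

lemma inj_forecast_encode: "inj forecast_encode"
proof (rule injI)
  fix I J assume "forecast_encode I = forecast_encode J"
  then have "lower I = lower J" "upper I = upper J"
    by (simp_all add: forecast_encode_def prod_encode_eq inj_eq[OF inj_rat_encode])
  then have "forecast_set I = forecast_set J" by (simp add: forecast_set_eq)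
  then show "I = J" by (simp add: forecast_set_inject)
qed

text \<open>
  The outcomes 0 and 1 are \<^const>\<open>False\<close> and \<^const>\<open>True\<close>. On interval forecasts the
  supremum is a maximum.
\<close>

definition upper_expectation :: "real set \<Rightarrow> (bool \<Rightarrow> real) \<Rightarrow> real" where
  "upper_expectation I f = (SUP p\<in>I. p * f True + (1 - p) * f False)"

lemma upper_expectation_attained:
  assumes "interval_forecast I"
  shows "\<exists>p\<in>I. upper_expectation I f = p * f True + (1 - p) * f False \<and>
           (\<forall>p'\<in>I. p' * f True + (1 - p') * f False \<le> p * f True + (1 - p) * f False)"
proof -
  let ?g = "\<lambda>p. p * f True + (1 - p) * f False"
  obtain a b where ab: "a \<le> b" "I = {a..b}"
    using assms by (auto simp: interval_forecast_def)
  have "continuous_on {a..b} ?g" by (intro continuous_intros)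
  then obtain p where p: "p \<in> I" "\<forall>p'\<in>I. ?g p' \<le> ?g p"
    using continuous_attains_sup[of "{a..b}" ?g] ab by auto
  then have "upper_expectation I f = ?g p"
    unfolding upper_expectation_def by (intro cSup_eq_maximum) auto
  with p show ?thesis by blast
qed


section \<open>Situations, paths and randomness\<close>

text \<open>Paths are indexed from 0: \<open>\<omega> n\<close> is the outcome usually written with index \<open>n + 1\<close>.\<close>

type_synonym situation = "bool list"
type_synonym path = "nat \<Rightarrow> bool"
type_synonym preq_situation = "(rational_forecast \<times> bool) list"
type_synonym preq_path = "nat \<Rightarrow> rational_forecast \<times> bool"
type_synonym forecasting_system = "situation \<Rightarrow> rational_forecast"

definition path_prefix :: "(nat \<Rightarrow> 'a) \<Rightarrow> nat \<Rightarrow> 'a list" where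
  "path_prefix \<omega> n = map \<omega> [0..<n]"

definition situation_encode :: "situation \<Rightarrow> nat" where
  "situation_encode w = list_encode (map of_bool w)"

definition preq_situation_encode :: "preq_situation \<Rightarrow> nat" where
  "preq_situation_encode v =
     list_encode (map (\<lambda>(I, x). prod_encode (forecast_encode I, of_bool x)) v)"

definition recursive_forecasting_system :: "forecasting_system \<Rightarrow> bool" where
  "recursive_forecasting_system \<phi> \<longleftrightarrow>
     recursive_map situation_encode rat_encode (\<lambda>w. lower (\<phi> w)) \<and>
     recursive_map situation_encode rat_encode (\<lambda>w. upper (\<phi> w))"

definition forecasts_along :: "forecasting_system \<Rightarrow> path \<Rightarrow> nat \<Rightarrow> rational_forecast" where
  "forecasts_along \<phi> \<omega> n = \<phi> (path_prefix \<omega> n)"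

definition test_supermartingale :: "forecasting_system \<Rightarrow> (situation \<Rightarrow> real) \<Rightarrow> bool" where
  "test_supermartingale \<phi> T \<longleftrightarrow>
     (\<forall>w. 0 \<le> T w) \<and> T [] = 1 \<and>
     (\<forall>w. upper_expectation (forecast_set (\<phi> w)) (\<lambda>x. T (w @ [x])) \<le> T w)"

definition martin_loef_random :: "forecasting_system \<Rightarrow> path \<Rightarrow> bool" where
  "martin_loef_random \<phi> \<omega> \<longleftrightarrow>
     (\<forall>T. lower_semicomputable situation_encode T \<longrightarrow> test_supermartingale \<phi> T \<longrightarrow>
        limsup (\<lambda>n. ereal (T (path_prefix \<omega> n))) < \<infinity>)"

definition test_superfarthingale :: "(preq_situation \<Rightarrow> real) \<Rightarrow> bool" where
  "test_superfarthingale F \<longleftrightarrow>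
     (\<forall>v. 0 \<le> F v) \<and> F [] = 1 \<and>
     (\<forall>v I. upper_expectation (forecast_set I) (\<lambda>x. F (v @ [(I, x)])) \<le> F v)"

definition non_degenerate :: "preq_path \<Rightarrow> bool" where
  "non_degenerate \<upsilon> \<longleftrightarrow> (\<forall>n. forecast_set (fst (\<upsilon> n)) \<noteq> {1 - of_bool (snd (\<upsilon> n))})"

definition game_random :: "preq_path \<Rightarrow> bool" where
  "game_random \<upsilon> \<longleftrightarrow>
     non_degenerate \<upsilon> \<and>
     (\<forall>F. lower_semicomputable preq_situation_encode F \<longrightarrow> test_superfarthingale F \<longrightarrow>
        limsup (\<lambda>n. ereal (F (path_prefix \<upsilon> n))) < \<infinity>)"

definition pair_path :: "(nat \<Rightarrow> rational_forecast) \<Rightarrow> path \<Rightarrow> preq_path" where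
  "pair_path \<iota> \<omega> n = (\<iota> n, \<omega> n)"

end

(* Substituting the forecasts of the system into a superfarthingale F, that is, putting
   T(x_1,...,x_n) = F(phi(), x_1, phi(x_1), x_2, ..., phi(x_1,...,x_(n-1)), x_n), gives a test
   supermartingale for phi with the same values along the path. T is lower semicomputable
   because the substitution is recursive: phi is, and only finitely many of its values, at the
   prefixes of the situation, are needed. *)
theory Submission
  imports Defs
begin

section \<open>Programs on encoded data\<close>

text \<open>
  Arguments range over an arbitrary type \<open>'d\<close>, presented to the program through \<open>e\<close>. A program
  therefore need not halt on argument lists that encode nothing, and the programs supplied for the
  forecasting system can be composed with total ones.
\<close>

definition computable :: "('d \<Rightarrow> nat list) \<Rightarrow> ('d \<Rightarrow> nat) \<Rightarrow> bool" where
  "computable e f \<longleftrightarrow> (\<exists>p. \<forall>d. rec_eval p (e d) (f d))"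

lemma recursive_map_iff_computable:
  "recursive_map enc_d enc_r f \<longleftrightarrow> computable (\<lambda>d. [enc_d d]) (\<lambda>d. enc_r (f d))"
  by (simp add: recursive_map_def computable_def)

section \<open>Projections, composition, recursion and search\<close>

lemma computable_proj:
  fixes f0 f1 f2 f3 :: "'a \<Rightarrow> nat"
  shows
  "computable (\<lambda>d. f0 d # xs d) f0"
  "computable (\<lambda>d. f0 d # f1 d # xs d) f1"
  "computable (\<lambda>d. f0 d # f1 d # f2 d # xs d) f2"
  "computable (\<lambda>d. f0 d # f1 d # f2 d # f3 d # xs d) f3"
proof -
  have proj: "computable e f" if "\<And>d. i < length (e d) \<and> e d ! i = f d"
    for i e and f :: "'a \<Rightarrow> nat"
    unfolding computable_def using that rec_eval.proj by metis
  show "computable (\<lambda>d. f0 d # xs d) f0"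
    by (rule proj[of 0]) simp
  show "computable (\<lambda>d. f0 d # f1 d # xs d) f1"
    by (rule proj[of 1]) simp
  show "computable (\<lambda>d. f0 d # f1 d # f2 d # xs d) f2"
    by (rule proj[of 2]) simp
  show "computable (\<lambda>d. f0 d # f1 d # f2 d # f3 d # xs d) f3"
    by (rule proj[of 3]) simp
qed

text \<open>The programs are chosen before \<open>d\<close>, because one \<open>Comp\<close> has to
  serve every argument.\<close>

lemma computable_programs:
  assumes "\<forall>f\<in>set fs. computable e f"
  shows "\<exists>ps. \<forall>d. list_all2 (\<lambda>p y. rec_eval p (e d) y) ps (map (\<lambda>f. f d) fs)"
  using assms
proof (induction fs)
  case Nil
  then show ?case by (intro exI[of _ "[]"]) simp
next
  case (Cons f fs)
  then obtain ps p where "\<forall>d. list_all2 (\<lambda>p y. rec_eval p (e d) y) ps (map (\<lambda>f. f d) fs)"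
    and "\<forall>d. rec_eval p (e d) (f d)"
    by (auto simp: computable_def)
  then show ?case by (intro exI[of _ "p # ps"]) simp
qed

text \<open>\<open>Comp\<close> runs the program for \<open>g\<close> only on
  \<open>e' (h d)\<close>, the presentation of a genuine element. So \<open>h\<close> needs no
  program of its own: the components listed in \<open>fs\<close> suffice.\<close>

lemma computable_compose:
  assumes "computable e' g" and "\<And>d. e' (h d) = map (\<lambda>f. f d) fs"
    and "\<forall>f\<in>set fs. computable e f"
  shows "computable e (\<lambda>d. g (h d))"
proof -
  obtain p where p: "\<And>x. rec_eval p (e' x) (g x)"
    using assms(1) by (auto simp: computable_def)
  obtain ps where ps: "\<And>d. list_all2 (\<lambda>p y. rec_eval p (e d) y) ps (map (\<lambda>f. f d) fs)"
    using computable_programs[OF assms(3)] by blast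
  have "rec_eval (Comp p ps) (e d) (g (h d))" for d
    using ps[of d] p[of "h d"] by (auto intro: rec_eval.comp simp: assms(2))
  then show ?thesis unfolding computable_def by blast
qed

lemma computable_compose1:
  assumes "computable (\<lambda>x. [c x]) g" and "computable e (\<lambda>d. c (h d))"
  shows "computable e (\<lambda>d. g (h d))"
  by (rule computable_compose[where fs = "[\<lambda>d. c (h d)]", OF assms(1)]) (simp_all add: assms)

lemma computable_compose2:
  assumes "computable (\<lambda>(x, y). [x, c y]) (\<lambda>(x, y). g x y)"
    and "computable e k" and "computable e (\<lambda>d. c (h d))"
  shows "computable e (\<lambda>d. g (k d) (h d))"
  using computable_compose[where fs = "[k, \<lambda>d. c (h d)]" and h = "\<lambda>d. (k d, h d)", OF assms(1)]
    assms(2,3) by simp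

lemma computable_0: "computable e (\<lambda>d. 0)"
  unfolding computable_def using rec_eval.zero by blast

lemma computable_Suc:
  assumes "computable e f"
  shows "computable e (\<lambda>d. Suc (f d))"
proof -
  have "computable (\<lambda>x. [x]) Suc"
    unfolding computable_def using rec_eval.succ by blast
  then show ?thesis using assms by (rule computable_compose1)
qed

lemma computable_rec_nat:
  assumes "computable e b" and "computable (\<lambda>(i, r, d). i # r # e d) (\<lambda>(i, r, d). s i r d)"
  shows "computable (\<lambda>(n, d). n # e d) (\<lambda>(n, d). rec_nat (b d) (\<lambda>i r. s i r d) n)"
proof -
  obtain p q where p: "\<And>d. rec_eval p (e d) (b d)"
    and q: "\<And>i r d. rec_eval q (i # r # e d) (s i r d)"
    using assms by (auto simp: computable_def)
  have "rec_eval (PrimRec p q) (n # e d) (rec_nat (b d) (\<lambda>i r. s i r d) n)" for n d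
    by (induction n) (auto intro: rec_eval.prim_0 rec_eval.prim_Suc p q)
  then show ?thesis unfolding computable_def by auto
qed

lemma computable_rec_nat1:
  assumes "computable (\<lambda>x. [c x]) b"
    and "computable (\<lambda>(i, r, x). [i, r, c x]) (\<lambda>(i, r, x). s i r x)"
    and "computable e n" and "computable e (\<lambda>d. c (h d))"
  shows "computable e (\<lambda>d. rec_nat (b (h d)) (\<lambda>i r. s i r (h d)) (n d))"
  using computable_rec_nat[OF assms(1,2)] assms(3,4) by (rule computable_compose2)

text \<open>Search with \<open>Mu\<close> halts because a zero exists; minimality makes every
  earlier value a successor, as the rule \<open>mu\<close> demands.\<close>

lemma computable_Least:
  assumes "computable (\<lambda>(k, d). k # e d) (\<lambda>(k, d). f k d)" and "\<And>d. \<exists>k. f k d = 0"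
  shows "computable e (\<lambda>d. LEAST k. f k d = 0)"
proof -
  obtain p where p: "\<And>k d. rec_eval p (k # e d) (f k d)"
    using assms(1) by (auto simp: computable_def)
  have "rec_eval (Mu p) (e d) (LEAST k. f k d = 0)" for d
  proof (rule rec_eval.mu)
    have "f (LEAST k. f k d = 0) d = 0"
      using assms(2) by (rule LeastI_ex)
    then show "rec_eval p ((LEAST k. f k d = 0) # e d) 0"
      using p by metis
    show "\<forall>m<(LEAST k. f k d = 0). \<exists>k. rec_eval p (m # e d) (Suc k)"
      using p not_less_Least by (metis not0_implies_Suc)
  qed
  then show ?thesis unfolding computable_def by blast
qed


section \<open>Arithmetic and list operations on codes\<close>

lemma computable_add:
  assumes "computable e f" and "computable e g"
  shows "computable e (\<lambda>d. f d + g d)"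
proof -
  have "rec_nat m (\<lambda>i. Suc) n = n + m" for m n :: nat
    by (induction n) simp_all
  moreover have "computable e (\<lambda>d. rec_nat (g d) (\<lambda>i r. Suc r) (f d))"
    by (rule computable_rec_nat1[where c = id and b = id and s = "\<lambda>i r x. Suc r" and h = g,
          unfolded id_def])
      (unfold case_prod_unfold, (intro computable_Suc computable_proj assms)+)
  ultimately show ?thesis by simp
qed

lemma computable_pred:
  assumes "computable e f"
  shows "computable e (\<lambda>d. f d - 1)"
proof -
  \<comment> \<open>The step returns its own index, the predecessor of the stage it produces; the
    base value covers \<open>0 - 1 = 0\<close>.\<close>
  have "rec_nat 0 (\<lambda>i r. i) n = n - 1" for n :: nat
    by (cases n) simp_all
  moreover have "computable e (\<lambda>d. rec_nat 0 (\<lambda>i r. i) (f d))"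
    by (rule computable_rec_nat1[where c = id and s = "\<lambda>i r x. i" and h = f])
      (unfold case_prod_unfold, (intro computable_0 computable_proj | simp add: assms)+)
  ultimately show ?thesis by simp
qed

lemma computable_diff:
  assumes "computable e f" and "computable e g"
  shows "computable e (\<lambda>d. f d - g d)"
proof -
  have "rec_nat m (\<lambda>i r. r - 1) n = m - n" for m n :: nat
    by (induction n) simp_all
  moreover have "computable e (\<lambda>d. rec_nat (f d) (\<lambda>i r. r - 1) (g d))"
    by (rule computable_rec_nat1[where c = id and b = id and s = "\<lambda>i r x. r - 1" and h = f,
          unfolded id_def])
      (unfold case_prod_unfold, (intro computable_pred computable_proj assms)+)
  ultimately show ?thesis by simp
qed

section \<open>The Cantor pairing function and its inverse\<close>

lemma computable_triangle:
  assumes "computable e f"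
  shows "computable e (\<lambda>d. triangle (f d))"
proof -
  have "rec_nat 0 (\<lambda>i r. r + Suc i) n = triangle n" for n
    by (induction n) simp_all
  moreover have "computable e (\<lambda>d. rec_nat 0 (\<lambda>i r. r + Suc i) (f d))"
    by (rule computable_rec_nat1[where c = id and s = "\<lambda>i r x. r + Suc i" and h = f])
      (unfold case_prod_unfold, (intro computable_0 computable_add computable_Suc computable_proj
          | simp add: assms)+)
  ultimately show ?thesis by simp
qed

lemma computable_prod_encode:
  assumes "computable e f" and "computable e g"
  shows "computable e (\<lambda>d. prod_encode (f d, g d))"
  unfolding prod_encode_def by (simp add: computable_add computable_triangle assms)

text \<open>\<open>prod_encode (a, b)\<close> is \<open>triangle (a + b) + a\<close>, which lies
  below \<open>triangle (Suc (a + b))\<close> but not below any earlier triangular number. Truncated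
  subtraction turns this inequality into a zero to search for.\<close>

lemma Least_triangle_eq: "(LEAST k. Suc (prod_encode (a, b)) - triangle (Suc k) = 0) = a + b"
proof (rule Least_equality)
  show "Suc (prod_encode (a, b)) - triangle (Suc (a + b)) = 0"
    by (simp add: prod_encode_def)
next
  fix k assume k: "Suc (prod_encode (a, b)) - triangle (Suc k) = 0"
  show "a + b \<le> k"
  proof (rule ccontr)
    assume "\<not> a + b \<le> k"
    then have "triangle (Suc k) \<le> triangle (a + b)"
      unfolding triangle_def by (intro div_le_mono mult_le_mono) auto
    with k show False by (simp add: prod_encode_def)
  qed
qed

lemma computable_prod_decode:
  assumes "computable e f"
  shows "computable e (\<lambda>d. fst (prod_decode (f d)))"
    and "computable e (\<lambda>d. snd (prod_decode (f d)))"
proof -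
  \<comment> \<open>The diagonal of the pair coded by \<open>m\<close>, that is, the sum of its
    components. Removing its triangular number from \<open>m\<close> leaves the first component, and
    the rest of the sum is the second.\<close>
  define s where "s m = (LEAST k. Suc m - triangle (Suc k) = 0)" for m
  have s: "s m = fst (prod_decode m) + snd (prod_decode m)" for m
    using Least_triangle_eq[of "fst (prod_decode m)" "snd (prod_decode m)"] by (simp add: s_def)
  have m: "m = triangle (s m) + fst (prod_decode m)" for m
    using prod_decode_inverse[of m] by (cases "prod_decode m") (simp add: s prod_encode_def)
  have "computable (\<lambda>m. [m]) s"
    unfolding s_def
  proof (rule computable_Least)
    show "computable (\<lambda>(k, m). [k, m]) (\<lambda>(k, m). Suc m - triangle (Suc k))"
      unfolding case_prod_unfold
      by (intro computable_diff computable_triangle computable_Suc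
          computable_proj)
    show "\<exists>k. Suc m - triangle (Suc k) = 0" for m
      \<comment> \<open>\<open>triangle (Suc m) = triangle m + Suc m\<close> already exceeds
        \<open>m\<close>.\<close>
      by (intro exI[of _ m]) simp
  qed
  then have cs: "computable e (\<lambda>d. s (f d))"
    by (rule computable_compose1) (rule assms)
  have fst_eq: "fst (prod_decode m) = m - triangle (s m)" for m
    using m[of m] by linarith
  then show fst: "computable e (\<lambda>d. fst (prod_decode (f d)))"
    by (simp add: computable_diff computable_triangle cs assms)
  have "snd (prod_decode m) = s m - fst (prod_decode m)" for m
    by (simp add: s)
  then show "computable e (\<lambda>d. snd (prod_decode (f d)))"
    by (simp add: computable_diff cs fst)
qed

section \<open>Operations on list codes\<close>

lemma prod_decode_0: "prod_decode 0 = (0, 0)"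
  by (simp add: prod_decode_def prod_decode_aux.simps)

lemma computable_list_encode_drop:
  assumes "computable e n" and "computable e (\<lambda>d. list_encode (xs d))"
  shows "computable e (\<lambda>d. list_encode (drop (n d) (xs d)))"
proof -
  \<comment> \<open>A nonempty list is coded by the successor of a pair. The code 0 of
    \<open>[]\<close> stays 0, since \<open>0 - 1 = 0\<close> decodes to \<open>(0, 0)\<close>; this
    matches \<open>tl [] = []\<close>.\<close>
  have tl: "list_encode (tl ys) = snd (prod_decode (list_encode ys - 1))" for ys
    by (cases ys) (simp_all add: prod_decode_0)
  have "rec_nat (list_encode ys) (\<lambda>i r. snd (prod_decode (r - 1))) k = list_encode (drop k ys)"
    for k ys
    by (induction k) (simp_all add: drop_Suc tl_drop tl[unfolded One_nat_def, symmetric])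
  moreover have
    "computable e (\<lambda>d. rec_nat (list_encode (xs d)) (\<lambda>i r. snd (prod_decode (r - 1))) (n d))"
    by (rule computable_rec_nat1[where c = list_encode and b = list_encode
          and s = "\<lambda>i r x. snd (prod_decode (r - 1))" and h = xs])
      (unfold case_prod_unfold,
        (intro computable_prod_decode computable_pred computable_proj assms)+)
  ultimately show ?thesis by simp
qed

text \<open>The entry is the head of what remains after dropping \<open>n d\<close> entries; the
  default 0 is what decoding yields on the code of \<open>[]\<close>.\<close>

lemma computable_nth:
  assumes "computable e n" and "computable e (\<lambda>d. list_encode (xs d))"
  shows "computable e (\<lambda>d. if n d < length (xs d) then xs d ! n d else 0)"
proof -
  have "fst (prod_decode (list_encode (drop k ys) - 1)) = (if k < length ys then ys ! k else 0)"
    for k ys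
  proof (cases "k < length ys")
    case True
    then show ?thesis by (subst Cons_nth_drop_Suc[symmetric]) simp_all
  qed (simp add: prod_decode_0)
  moreover have "computable e (\<lambda>d. fst (prod_decode (list_encode (drop (n d) (xs d)) - 1)))"
    by (intro computable_prod_decode computable_pred computable_list_encode_drop assms)
  ultimately show ?thesis by (simp only:)
qed

text \<open>Only \<open>[]\<close> has code 0, so a search over the number of dropped entries finds
  the length.\<close>

lemma computable_length: "computable (\<lambda>xs. [list_encode xs]) length"
proof -
  have "computable (\<lambda>xs. [list_encode xs]) (\<lambda>xs. LEAST k. list_encode (drop k xs) = 0)"
  proof (rule computable_Least)
    show "computable (\<lambda>(k, xs). [k, list_encode xs]) (\<lambda>(k, xs). list_encode (drop k xs))"
      unfolding case_prod_unfold
      by (intro computable_list_encode_drop computable_proj)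
    show "\<exists>k. list_encode (drop k xs) = 0" for xs
      by (intro exI[of _ "length xs"]) simp
  qed
  moreover have "(LEAST k. list_encode (drop k xs) = 0) = length xs" for xs
    using list_encode_eq[of _ "[]"] by (intro Least_equality) simp_all
  ultimately show ?thesis by simp
qed

text \<open>List codes nest to the right, so the table is built from its last entry backwards.\<close>

lemma computable_list_encode_map_upt:
  assumes "computable (\<lambda>(k, x). [k, c x]) (\<lambda>(k, x). g k x)"
  shows "computable (\<lambda>(n, x). [n, c x]) (\<lambda>(n, x). list_encode (map (\<lambda>k. g k x) [0..<n]))"
proof -
  \<comment> \<open>Here \<open>t\<close> is the pair \<open>(n, x)\<close>. The length is carried
    as a parameter because step \<open>j\<close> counts from the end and prepends the entry with
    index \<open>n - Suc j\<close>.\<close>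
  let ?s = "\<lambda>j r t. Suc (prod_encode (g (fst t - Suc j) (snd t), r))"
  have rec: "rec_nat 0 (\<lambda>j r. ?s j r (n, x)) j = list_encode (map (\<lambda>k. g k x) [n - j..<n])"
    if "j \<le> n" for j n x
    using that
  proof (induction j)
    case (Suc j)
    then have "[n - Suc j..<n] = (n - Suc j) # [n - j..<n]"
      by (subst upt_conv_Cons) (simp_all add: Suc_diff_Suc)
    with Suc show ?case by simp
  qed simp
  have "computable (\<lambda>(j, r, t). j # r # [fst t, c (snd t)]) (\<lambda>(j, r, t). ?s j r t)"
    unfolding case_prod_unfold
    by (intro computable_Suc computable_prod_encode computable_compose2[OF assms] computable_diff
        computable_proj)
  then have "computable (\<lambda>(n, t). n # [fst t, c (snd t)])
      (\<lambda>(n, t). rec_nat 0 (\<lambda>j r. ?s j r t) n)"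
    by (rule computable_rec_nat[OF computable_0])
  \<comment> \<open>\<open>fst t\<close> is fed in twice, as the recursion counter and as part of
    the parameter.\<close>
  then have "computable (\<lambda>t. [fst t, c (snd t)])
      (\<lambda>t. case (fst t, t) of (n, t) \<Rightarrow> rec_nat 0 (\<lambda>j r. ?s j r t) n)"
    by (rule computable_compose[where fs = "[fst, fst, \<lambda>t. c (snd t)]"])
      (auto intro: computable_proj)
  moreover have "(case (fst t, t) of (n, t) \<Rightarrow> rec_nat 0 (\<lambda>j r. ?s j r t) n) =
      list_encode (map (\<lambda>k. g k (snd t)) [0..<fst t])" for t
    using rec[of "fst t" "fst t" "snd t"] by simp
  ultimately show ?thesis by (simp add: case_prod_unfold)
qed


section \<open>Substituting forecasts\<close>

text \<open>Indexing by position, instead of recursion on \<open>w\<close>, lets the code be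
  computed as a table.\<close>

definition with_forecasts :: "forecasting_system \<Rightarrow> situation \<Rightarrow> preq_situation" where
  "with_forecasts \<phi> w = map (\<lambda>k. (\<phi> (take k w), w ! k)) [0..<length w]"

lemma with_forecasts_Nil: "with_forecasts \<phi> [] = []"
  by (simp add: with_forecasts_def)

text \<open>Each \<open>take k\<close> with \<open>k \<le> length w\<close> ignores the new outcome.
  Hence the supermartingale condition at \<open>w\<close> is the superfarthingale condition at
  \<open>with_forecasts \<phi> w\<close> for the interval \<open>\<phi> w\<close>.\<close>

lemma with_forecasts_snoc: "with_forecasts \<phi> (w @ [x]) = with_forecasts \<phi> w @ [(\<phi> w, x)]"
  by (simp add: with_forecasts_def nth_append)

text \<open>For \<open>k < n\<close>, \<open>take k\<close> of the prefix of length \<open>n\<close>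
  is the prefix of length \<open>k\<close>.\<close>

lemma with_forecasts_path_prefix:
  "with_forecasts \<phi> (path_prefix \<omega> n) = path_prefix (pair_path (forecasts_along \<phi> \<omega>) \<omega>) n"
  by (auto simp: with_forecasts_def path_prefix_def pair_path_def forecasts_along_def take_map)

text \<open>Tabulation is used twice: for the prefixes of \<open>w\<close> on which the programs for
  \<open>\<phi>\<close> run, and for the resulting rows.\<close>

lemma computable_with_forecasts:
  assumes "recursive_forecasting_system \<phi>"
  shows "computable (\<lambda>w. [situation_encode w])
    (\<lambda>w. preq_situation_encode (with_forecasts \<phi> w))"
proof -
  \<comment> \<open>False beyond the end agrees with the default 0 of
    \<open>computable_nth\<close>.\<close>
  define bit where "bit k w \<longleftrightarrow> k < length w \<and> w ! k" for k and w :: situation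
  \<comment> \<open>Padded with \<^const>\<open>False\<close> beyond the length of \<open>w\<close>, so that every row is a situation.\<close>
  define pad where "pad k w = map (\<lambda>i. bit i w) [0..<k]" for k w
  have pad_eq: "pad k w = take k w" if "k \<le> length w" for k w
    using that by (intro nth_equalityI) (simp_all add: pad_def bit_def)
  have bit_code: "computable (\<lambda>(k, w). [k, situation_encode w]) (\<lambda>(k, w). of_bool (bit k w))"
  proof -
    let ?c = "\<lambda>t :: nat \<times> situation. map of_bool (snd t) :: nat list"
    have "computable (\<lambda>t. [fst t, situation_encode (snd t)])
        (\<lambda>t. if fst t < length (?c t) then ?c t ! fst t else 0)"
      unfolding situation_encode_def by (intro computable_nth computable_proj)
    moreover have "(if fst t < length (?c t) then ?c t ! fst t else 0) =
        of_bool (bit (fst t) (snd t))" for t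
      by (simp add: bit_def)
    ultimately show ?thesis by (simp only: case_prod_unfold)
  qed
  have pad_code: "computable (\<lambda>t. [fst t, situation_encode (snd t)])
      (\<lambda>t. situation_encode (pad (fst t) (snd t)))"
    using computable_list_encode_map_upt[OF bit_code]
    by (simp add: situation_encode_def pad_def case_prod_unfold comp_def)
  define entry where "entry k w =
    prod_encode (forecast_encode (\<phi> (pad k w)), of_bool (bit k w))" for k w
  have "computable (\<lambda>t. [fst t, situation_encode (snd t)])
      (\<lambda>t. rat_encode (lower (\<phi> (pad (fst t) (snd t)))))"
    and "computable (\<lambda>t. [fst t, situation_encode (snd t)])
      (\<lambda>t. rat_encode (upper (\<phi> (pad (fst t) (snd t)))))"
    using assms unfolding recursive_forecasting_system_def recursive_map_iff_computable
    by (auto intro: computable_compose1[where h = "\<lambda>t. pad (fst t) (snd t)", OF _ pad_code])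
  then have "computable (\<lambda>(k, w). [k, situation_encode w]) (\<lambda>(k, w). entry k w)"
    using bit_code unfolding entry_def forecast_encode_def case_prod_unfold
    by (intro computable_prod_encode)
  note table = computable_list_encode_map_upt[OF this]
  have "computable (\<lambda>w. [situation_encode w]) (\<lambda>w. length (map of_bool w :: nat list))"
    unfolding situation_encode_def
    by (rule computable_compose1[OF computable_length, where h = "map of_bool"])
      (rule computable_proj)
  then have "computable (\<lambda>w. [situation_encode w])
      (\<lambda>w. list_encode (map (\<lambda>k. entry k w) [0..<length w]))"
    using computable_compose2[OF table, where h = "\<lambda>w. w"]
    by (simp add: computable_proj)
  moreover have "map (\<lambda>k. entry k w) [0..<length w] =
      map (\<lambda>(I, x). prod_encode (forecast_encode I, of_bool x)) (with_forecasts \<phi> w)" for w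
    by (simp add: with_forecasts_def entry_def pad_eq bit_def)
  ultimately show ?thesis by (simp add: preq_situation_encode_def)
qed

text \<open>Monotonicity and convergence are required at each fixed argument, so the approximations
  of \<open>F\<close> keep them under substitution; only recursiveness takes work.\<close>

lemma lower_semicomputable_with_forecasts:
  assumes "recursive_forecasting_system \<phi>" and "lower_semicomputable preq_situation_encode F"
  shows "lower_semicomputable situation_encode (\<lambda>w. F (with_forecasts \<phi> w))"
proof -
  obtain q where q: "recursive_map (\<lambda>(v, n). prod_encode (preq_situation_encode v, n)) rat_encode q"
    and mono: "\<And>v n. q (v, n) \<le> q (v, Suc n)"
    and lim: "\<And>v. (\<lambda>m. real_of_rat (q (v, m))) \<longlonglongrightarrow> F v"
    using assms(2) unfolding lower_semicomputable_def by blast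
  define q' where "q' t = q (with_forecasts \<phi> (fst t), snd t)" for t
  let ?e = "\<lambda>t. [prod_encode (situation_encode (fst t), snd t)]"
  \<comment> \<open>The program receives one number, the pair of the situation's code and the stage;
    it is split before the substitution and paired again afterwards.\<close>
  have "computable ?e (\<lambda>t. fst (prod_decode (prod_encode (situation_encode (fst t), snd t))))"
    and "computable ?e (\<lambda>t. snd (prod_decode (prod_encode (situation_encode (fst t), snd t))))"
    by (intro computable_prod_decode computable_proj; simp)+
  then have "computable ?e (\<lambda>t. situation_encode (fst t))" and "computable ?e snd"
    by simp_all
  then have "computable ?e
      (\<lambda>t. prod_encode (preq_situation_encode (with_forecasts \<phi> (fst t)), snd t))"
    by (intro computable_prod_encode computable_compose1[OF computable_with_forecasts[OF assms(1)]])
  then have "recursive_map (\<lambda>(w, n). prod_encode (situation_encode w, n)) rat_encode q'"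
    using q unfolding recursive_map_iff_computable case_prod_unfold q'_def
    by (auto intro: computable_compose1[where h = "\<lambda>t. (with_forecasts \<phi> (fst t), snd t)"])
  then show ?thesis
    unfolding lower_semicomputable_def
    by (intro exI[of _ q']) (simp add: q'_def mono lim)
qed

lemma test_supermartingale_with_forecasts:
  assumes "test_superfarthingale F"
  shows "test_supermartingale \<phi> (\<lambda>w. F (with_forecasts \<phi> w))"
  using assms unfolding test_superfarthingale_def test_supermartingale_def
  by (simp add: with_forecasts_Nil with_forecasts_snoc)

theorem proposition6:
  fixes \<phi> :: forecasting_system and \<omega> :: path
  assumes "recursive_forecasting_system \<phi>"
    and "martin_loef_random \<phi> \<omega>"
    and "non_degenerate (pair_path (forecasts_along \<phi> \<omega>) \<omega>)"
  shows "game_random (pair_path (forecasts_along \<phi> \<omega>) \<omega>)"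
  unfolding game_random_def
proof (intro conjI allI impI)
  fix F assume "lower_semicomputable preq_situation_encode F" and "test_superfarthingale F"
  then have "limsup (\<lambda>n. ereal (F (with_forecasts \<phi> (path_prefix \<omega> n)))) < \<infinity>"
    using assms(1,2) lower_semicomputable_with_forecasts test_supermartingale_with_forecasts
    unfolding martin_loef_random_def by blast
  then show "limsup (\<lambda>n. ereal (F (path_prefix (pair_path (forecasts_along \<phi> \<omega>) \<omega>) n))) < \<infinity>"
    by (simp only: with_forecasts_path_prefix)
qed (rule assms(3))

end
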